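(* Let $L\subset\mathbb{P}^n$ be a line, let $Z\subset L$ be a set of $m$ points, and let $1\le r\leq\min\{m,n\}$. If $L\cap\Delta_{n-2}=\emptyset$ and $Z\cap\Delta_{n-1}=\emptyset$, then the square-free Hadamard power $Z^{\underline{\star} r}$ is a star configuration in $M=L^{\star r}$.
   Context: The base field is $\mathbb{C}$. $\Delta_i\subset\mathbb{P}^n$ is the set of points having at most $i+1$ non-zero homogeneous coordinates (so $\Delta_{-1}=\emptyset$). For points $p=[a_0:\dots:a_n]$, $q=[b_0:\dots:b_n]$ of $\mathbb{P}^n$, the Hadamard product $p\star q=[a_0b_0:\dots:a_nb_n]$ is defined when some $a_ib_i\neq0$, and is not defined otherwise. For varieties $X,Y\subset\mathbb{P}^n$, $X\star Y$ is the Zariski closure of $\{p\star q: p\in X,\ q\in Y,\ p\star q \text{ is defined}\}$. Hadamard powers are $X^{\star 0}=\{[1:\dots:1]\}$ and $X^{\star r}=X\star X^{\star(r-1)}$. For a finite set of points $Z\subset\mathbb{P}^n$, its $r$-th square-free Hadamard power is $Z^{\underline{\star} r}=\{p_1\star\cdots\star p_r: p_i\in Z,\ p_i\neq p_j\text{ for }i\neq j\}$. Linear spaces $H_1,\dots,H_m\subset M\subset\mathbb{P}^n$ with $r=\dim M=\dim H_i+1$ are in linear general position in $M$ if, whenever $i_1,\dots,i_j$ are distinct, $\dim(H_{i_1}\cap\dots\cap H_{i_j})=r-j$ for $j\le r$, and $H_{i_1}\cap\dots\cap H_{i_j}=\emptyset$ for $r<j$. A set of $\binom{m}{r}$ points $\mathbb{X}\subset\mathbb{P}^n$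 is a star configuration (in $M$) if there exist linear spaces $H_1,\dots,H_m\subset M\subset\mathbb{P}^n$ such that $r=\dim M=\dim H_i+1$, the $H_i$ are in linear general position in $M$, and $\mathbb{X}=\bigcup_{1\le i_1<\dots<i_r\le m}H_{i_1}\cap\dots\cap H_{i_r}$. *)

theory Defs
  imports "HOL-Analysis.Analysis" "HOL-Library.Poly_Mapping"
begin

definition proj_rel :: "complex ^ 'n \<Rightarrow> complex ^ 'n \<Rightarrow> bool" where
  "proj_rel a b \<longleftrightarrow> a \<noteq> 0 \<and> b \<noteq> 0 \<and> (\<exists>c. c \<noteq> 0 \<and> b = c *s a)"

lemma part_equivp_proj_rel: "part_equivp (proj_rel :: complex ^ 'n \<Rightarrow> complex ^ 'n \<Rightarrow> bool)"
proof (rule part_equivpI)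
  have "proj_rel (vec 1) (vec 1 :: complex ^ 'n)"
    by (auto simp: proj_rel_def vec_eq_iff intro!: exI[of _ 1])
  then show "\<exists>x. proj_rel x (x :: complex ^ 'n)" by blast
  show "symp (proj_rel :: complex ^ 'n \<Rightarrow> complex ^ 'n \<Rightarrow> bool)"
  proof (rule sympI)
    fix a b :: "complex ^ 'n"
    assume "proj_rel a b"
    then obtain c where c: "a \<noteq> 0" "b \<noteq> 0" "c \<noteq> 0" "b = c *s a"
      by (auto simp: proj_rel_def)
    then have "a = inverse c *s b" by (simp add: vec_eq_iff)
    with c show "proj_rel b a" unfolding proj_rel_def by (metis inverse_nonzero_iff_nonzero)
  qed
  show "transp (proj_rel :: complex ^ 'n \<Rightarrow> complex ^ 'n \<Rightarrow> bool)"
  proof (rule transpI)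
    fix a b d :: "complex ^ 'n"
    assume "proj_rel a b" "proj_rel b d"
    then show "proj_rel a d"
      unfolding proj_rel_def by (metis vector_smult_assoc mult_eq_0_iff)
  qed
qed

text \<open>Projective space over the complex numbers with homogeneous coordinates indexed by
  \<^typ>\<open>'n\<close>, so it is of dimension \<^term>\<open>CARD('n) - 1\<close>. For a nonzero vector \<open>a\<close>,
  \<open>point a\<close> is the point with homogeneous coordinates \<open>a\<close>; \<open>point 0\<close> is meaningless.\<close>

quotient_type 'n proj = "complex ^ 'n" / partial: proj_rel
  morphisms coords point
  by (rule part_equivp_proj_rel)

lift_definition nonzero_coords :: "'n::finite proj \<Rightarrow> 'n set" is "\<lambda>a. {i. a $ i \<noteq> 0}"
  by (auto simp: proj_rel_def)

definition Delta :: "int \<Rightarrow> 'n::finite proj set" where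
  "Delta i = {p. int (card (nonzero_coords p)) \<le> i + 1}"

text \<open>The result is \<^const>\<open>None\<close> where the Hadamard product is not defined.\<close>

lift_definition hadamard :: "'n::finite proj \<Rightarrow> 'n proj \<Rightarrow> 'n proj option" is
  "\<lambda>a b. if \<exists>i. a $ i * b $ i \<noteq> 0 then Some (\<chi> i. a $ i * b $ i) else None"
proof -
  fix a a' b b' :: "complex ^ 'n"
  assume "proj_rel a a'" "proj_rel b b'"
  then obtain c d where *: "c \<noteq> 0" "a' = c *s a" "d \<noteq> 0" "b' = d *s b"
    by (auto simp: proj_rel_def)
  have "proj_rel (\<chi> i. a $ i * b $ i) (\<chi> i. a' $ i * b' $ i)" if "\<exists>i. a $ i * b $ i \<noteq> 0"
    unfolding proj_rel_def using that *
    by (auto simp: vec_eq_iff intro!: exI[of _ "c * d"])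
  then show "rel_option proj_rel
      (if \<exists>i. a $ i * b $ i \<noteq> 0 then Some (\<chi> i. a $ i * b $ i) else None)
      (if \<exists>i. a' $ i * b' $ i \<noteq> 0 then Some (\<chi> i. a' $ i * b' $ i) else None)"
    using * by auto
qed

text \<open>Polynomials in the homogeneous coordinates, as finitely supported maps from exponent
  vectors to coefficients.\<close>

type_synonym 'n hpoly = "('n \<Rightarrow>\<^sub>0 nat) \<Rightarrow>\<^sub>0 complex"

definition eval_hpoly :: "'n::finite hpoly \<Rightarrow> complex ^ 'n \<Rightarrow> complex" where
  "eval_hpoly F a =
     (\<Sum>e\<in>Poly_Mapping.keys F. Poly_Mapping.lookup F e * (\<Prod>i\<in>UNIV. (a $ i) ^ Poly_Mapping.lookup e i))"

definition homogeneous :: "'n::finite hpoly \<Rightarrow> bool" where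
  "homogeneous F \<longleftrightarrow>
     (\<exists>d. \<forall>e\<in>Poly_Mapping.keys F. (\<Sum>i\<in>UNIV. Poly_Mapping.lookup e i) = d)"

definition zero_locus :: "'n::finite hpoly set \<Rightarrow> 'n proj set" where
  "zero_locus S = point ` {a. a \<noteq> 0 \<and> (\<forall>F\<in>S. eval_hpoly F a = 0)}"

definition zariski_closed :: "'n::finite proj set \<Rightarrow> bool" where
  "zariski_closed X \<longleftrightarrow> (\<exists>S. (\<forall>F\<in>S. homogeneous F) \<and> X = zero_locus S)"

definition zariski_closure :: "'n::finite proj set \<Rightarrow> 'n proj set" where
  "zariski_closure A = zariski_closed hull A"

definition hadamard_prod :: "'n::finite proj set \<Rightarrow> 'n proj set \<Rightarrow> 'n proj set" where
  "hadamard_prod X Y = zariski_closure {s. \<exists>p\<in>X. \<exists>q\<in>Y. hadamard p q = Some s}"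

primrec hadamard_power :: "'n::finite proj set \<Rightarrow> nat \<Rightarrow> 'n proj set" where
  "hadamard_power X 0 = {point (vec 1)}"
| "hadamard_power X (Suc r) = hadamard_prod X (hadamard_power X r)"

text \<open>The product of a list of points; it is defined iff some coordinate is nonzero in all
  of them, so the bracketing and the order are immaterial.\<close>

primrec hadamard_list :: "'n::finite proj list \<Rightarrow> 'n proj option" where
  "hadamard_list [] = Some (point (vec 1))"
| "hadamard_list (p # ps) = Option.bind (hadamard_list ps) (hadamard p)"

definition sqfree_hadamard_power :: "'n::finite proj set \<Rightarrow> nat \<Rightarrow> 'n proj set" where
  "sqfree_hadamard_power Z r =
     {s. \<exists>ps. length ps = r \<and> distinct ps \<and> set ps \<subseteq> Z \<and> hadamard_list ps = Some s}"

definition affine_cone :: "'n::finite proj set \<Rightarrow> (complex ^ 'n) set" where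
  "affine_cone X = insert 0 {a. a \<noteq> 0 \<and> point a \<in> X}"

text \<open>\<^const>\<open>vec.subspace\<close> and \<^const>\<open>vec.dim\<close> are over the complex scalars here. The empty set is a linear space, of dimension \<open>-1\<close>.\<close>

definition linear_space :: "'n::finite proj set \<Rightarrow> bool" where
  "linear_space X \<longleftrightarrow> vec.subspace (affine_cone X)"

definition linear_dim :: "'n::finite proj set \<Rightarrow> int" where
  "linear_dim X = int (vec.dim (affine_cone X)) - 1"

definition linear_general_position ::
    "nat \<Rightarrow> nat \<Rightarrow> (nat \<Rightarrow> 'n::finite proj set) \<Rightarrow> 'n proj set \<Rightarrow> bool" where
  "linear_general_position m r H M \<longleftrightarrow>
     linear_space M \<and> linear_dim M = int r \<and>
     (\<forall>i\<in>{1..m}. linear_space (H i) \<and> H i \<subseteq> M \<and> linear_dim (H i) + 1 = int r) \<and>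
     (\<forall>J. J \<subseteq> {1..m} \<and> J \<noteq> {} \<longrightarrow>
        (card J \<le> r \<longrightarrow> linear_dim (\<Inter>i\<in>J. H i) = int r - int (card J)) \<and>
        (r < card J \<longrightarrow> (\<Inter>i\<in>J. H i) = {}))"

text \<open>\<open>X\<close> is a star configuration in \<open>M\<close>, cut out by \<open>m\<close> linear spaces of codimension one
  in the linear space \<open>M\<close> of dimension \<open>r\<close>. Meant for \<open>r \<ge> 1\<close>: for \<open>r = 0\<close> the empty
  intersection below would be the whole projective space.\<close>

definition star_configuration ::
    "nat \<Rightarrow> nat \<Rightarrow> 'n::finite proj set \<Rightarrow> 'n proj set \<Rightarrow> bool" where
  "star_configuration m r M X \<longleftrightarrow>
     finite X \<and> card X = m choose r \<and>
     (\<exists>H. linear_general_position m r H M \<and>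
          X = (\<Union>J\<in>{J. J \<subseteq> {1..m} \<and> card J = r}. \<Inter>i\<in>J. H i))"

end

(* Choose a basis u, v of the cone over L with every coordinate of v nonzero and the point of v
   outside Z. With x_i = u_i / v_i, which are pairwise distinct since a point of L has at most one
   zero coordinate, the points of L are (v_i l(x_i))_i for polynomials l of degree at most 1, and
   those of Z come from l = X - a for pairwise distinct a. Hadamard products of points are
   products of polynomials, and every polynomial splits into linear factors, so L^{*r} consists of
   the points (v_i^r f(x_i))_i with deg f <= r; as r <= n, the polynomial f is determined up to a
   scalar. The hyperplane of L^{*r} attached to a point of Z is f(a) = 0. The polynomials of degree
   at most r vanishing at a set S are the multiples of the product of the X - a, a in S: a space of
   dimension r + 1 - |S| if |S| <= r, and zero otherwise. For |S| = r only the product itself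
   remains, up to a scalar, which is a point of the square-free power. *)
theory Submission
  imports Defs "HOL-Computational_Algebra.Fundamental_Theorem_Algebra"
begin

section \<open>Linear subspaces of projective space\<close>

lemma proj_rel_refl: "a \<noteq> 0 \<Longrightarrow> proj_rel a a"
  by (auto simp: proj_rel_def intro!: exI[of _ 1])

lemma proj_rel_coords: "proj_rel (coords p) (coords p)"
  by (rule Quotient3_rep_reflp[OF Quotient3_proj])

lemma coords_nonzero [simp]: "coords p \<noteq> 0"
  using proj_rel_coords[of p] by (simp add: proj_rel_def)

lemma point_coords [simp]: "point (coords p) = p"
  by (rule Quotient3_abs_rep[OF Quotient3_proj])

lemma point_eq_iff:
  assumes "a \<noteq> 0" "b \<noteq> 0"
  shows "point a = point b \<longleftrightarrow> (\<exists>c. c \<noteq> 0 \<and> b = c *s a)"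
  using Quotient3_rel[OF Quotient3_proj, of a b] assms proj_rel_refl[of a] proj_rel_refl[of b]
  by (auto simp: proj_rel_def)

lemma coords_point:
  assumes "a \<noteq> 0"
  obtains c where "c \<noteq> 0" "coords (point a) = c *s a"
  using point_eq_iff[OF assms coords_nonzero[of "point a"]] by auto

lemma nonzero_coords_point: "a \<noteq> 0 \<Longrightarrow> nonzero_coords (point a) = {i. a $ i \<noteq> 0}"
  by (rule nonzero_coords.abs_eq[OF proj_rel_refl])

lemma hadamard_point:
  assumes "a \<noteq> 0" "b \<noteq> 0"
  shows "hadamard (point a) (point b) =
    (if (\<chi> i. a $ i * b $ i) \<noteq> 0 then Some (point (\<chi> i. a $ i * b $ i)) else None)"
  using hadamard.abs_eq[OF proj_rel_refl[OF assms(1)] proj_rel_refl[OF assms(2)]]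
  by (simp add: vec_eq_iff)

text \<open>Membership is tested on the representative that \<open>coords\<close> picks. For a
  subspace \<open>V\<close> every representative gives the same answer, and
  \<open>affine_cone\<close> is then the inverse construction.\<close>

definition proj_space :: "(complex ^ 'n) set \<Rightarrow> 'n::finite proj set" where
  "proj_space V = {p. coords p \<in> V}"

lemma point_in_proj_space:
  assumes "vec.subspace V" "a \<noteq> 0"
  shows "point a \<in> proj_space V \<longleftrightarrow> a \<in> V"
proof -
  obtain c where c: "c \<noteq> 0" "coords (point a) = c *s a"
    using coords_point[OF assms(2)] .
  then have "a = inverse c *s coords (point a)" by (simp add: vec_eq_iff)
  then show ?thesis
    using c(2) vec.subspace_scale[OF assms(1)] unfolding proj_space_def by (metis mem_Collect_eq)
qed

lemma affine_cone_proj_space: "vec.subspace V \<Longrightarrow> affine_cone (proj_space V) = V"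
  unfolding affine_cone_def using point_in_proj_space[of V] vec.subspace_0[of V] by auto

lemma proj_space_affine_cone: "proj_space (affine_cone X) = X"
  unfolding affine_cone_def proj_space_def by auto

lemma linear_space_proj_space: "vec.subspace V \<Longrightarrow> linear_space (proj_space V)"
  by (simp add: linear_space_def affine_cone_proj_space)

lemma linear_dim_proj_space:
  "vec.subspace V \<Longrightarrow> linear_dim (proj_space V) = int (vec.dim V) - 1"
  by (simp add: linear_dim_def affine_cone_proj_space)

lemma proj_space_Inter: "proj_space (\<Inter>i\<in>I. V i) = (\<Inter>i\<in>I. proj_space (V i))"
  by (auto simp: proj_space_def)

section \<open>Linear forms and Zariski closedness of linear spaces\<close>

definition linear_form :: "complex ^ 'n \<Rightarrow> 'n::finite hpoly" where
  "linear_form c = (\<Sum>i\<in>UNIV. Poly_Mapping.single (Poly_Mapping.single i 1) (c $ i))"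

lemma single_one_eq_iff:
  "Poly_Mapping.single i (1::nat) = Poly_Mapping.single j 1 \<longleftrightarrow> i = j"
  by (metis lookup_single_eq lookup_single_not_eq one_neq_zero)

lemma lookup_linear_form:
  "Poly_Mapping.lookup (linear_form c) e =
     (\<Sum>i\<in>UNIV. c $ i when Poly_Mapping.single i 1 = e)"
  by (simp add: linear_form_def lookup_sum lookup_single)

lemma keys_linear_form:
  "Poly_Mapping.keys (linear_form c) \<subseteq> range (\<lambda>i. Poly_Mapping.single i 1)"
proof
  fix e assume "e \<in> Poly_Mapping.keys (linear_form c)"
  then have "(\<Sum>i\<in>UNIV. c $ i when Poly_Mapping.single i 1 = e) \<noteq> 0"
    by (simp add: in_keys_iff lookup_linear_form)
  then obtain i where "(c $ i when Poly_Mapping.single i 1 = e) \<noteq> 0"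
    by (meson sum.neutral)
  then show "e \<in> range (\<lambda>i. Poly_Mapping.single i 1)" by (auto simp: when_def split: if_splits)
qed

lemma homogeneous_linear_form: "homogeneous (linear_form c)"
  unfolding homogeneous_def
proof (intro exI[of _ 1] ballI)
  fix e assume "e \<in> Poly_Mapping.keys (linear_form c)"
  then obtain i where "e = Poly_Mapping.single i 1" using keys_linear_form by blast
  then show "(\<Sum>j\<in>UNIV. Poly_Mapping.lookup e j) = 1"
    by (simp add: lookup_single when_def)
qed

lemma eval_linear_form: "eval_hpoly (linear_form c) a = (\<Sum>i\<in>UNIV. c $ i * a $ i)"
proof -
  have pr: "(\<Prod>j\<in>UNIV. (a $ j) ^ Poly_Mapping.lookup (Poly_Mapping.single i 1) j) = a $ i" for i
  proof -
    have "(\<Prod>j\<in>UNIV. (a $ j) ^ Poly_Mapping.lookup (Poly_Mapping.single i 1) j)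
       = (\<Prod>j\<in>UNIV. if i = j then a $ j else 1)"
      by (intro prod.cong) (auto simp: lookup_single when_def)
    then show ?thesis by simp
  qed
  have lk: "Poly_Mapping.lookup (linear_form c) (Poly_Mapping.single i 1) = c $ i" for i
    unfolding lookup_linear_form single_one_eq_iff by (simp add: when_def)
  have "eval_hpoly (linear_form c) a =
    (\<Sum>e\<in>range (\<lambda>i. Poly_Mapping.single i 1). Poly_Mapping.lookup (linear_form c) e *
       (\<Prod>i\<in>UNIV. (a $ i) ^ Poly_Mapping.lookup e i))"
    unfolding eval_hpoly_def
    by (rule sum.mono_neutral_left) (use keys_linear_form in \<open>auto simp: in_keys_iff\<close>)
  also have "\<dots> = (\<Sum>i\<in>UNIV. c $ i * a $ i)"
    by (subst sum.reindex) (auto simp: inj_on_def single_one_eq_iff pr lk simp del: One_nat_def)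
  finally show ?thesis .
qed

text \<open>A basis of \<open>V\<close> stays independent when \<open>a\<close> is added, so some
  linear \<open>g\<close> kills \<open>V\<close> and fixes \<open>a\<close>. The row of its matrix
  at a nonzero coordinate of \<open>a\<close> is the form.\<close>

lemma separating_linear_form:
  fixes V :: "(complex ^ 'n::finite) set"
  assumes V: "vec.subspace V" and a: "a \<notin> V"
  obtains c where "\<And>y. y \<in> V \<Longrightarrow> eval_hpoly (linear_form c) y = 0"
    "eval_hpoly (linear_form c) a \<noteq> 0"
proof -
  obtain B where B: "B \<subseteq> V" "vec.independent B" "V \<subseteq> vec.span B"
    using vec.basis_exists[of V] by metis
  have sp: "vec.span B = V" using vec.span_subspace[OF B(1,3) V] .
  then have ind: "vec.independent (insert a B)"
    using a B by (auto simp: vec.independent_insert)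
  obtain g where g: "Vector_Spaces.linear (*s) (*s) g"
    "\<forall>x\<in>insert a B. g x = (if x = a then a else 0)"
    using vec.linear_independent_extend[OF ind, of "\<lambda>x. if x = a then a else 0"] by blast
  have gV: "g y = 0" if "y \<in> V" for y
    by (rule vec.linear_eq_0_on_span[OF g(1), of B])
      (use g(2) a B that sp in auto)
  have "a \<noteq> 0" using a vec.subspace_0[OF V] by auto
  then obtain j where j: "a $ j \<noteq> 0" by (auto simp: vec_eq_iff)
  have ev: "eval_hpoly (linear_form (matrix g $ j)) y = g y $ j" for y
    using matrix_works[OF g(1), of y] by (auto simp: eval_linear_form matrix_vector_mult_def vec_eq_iff)
  show thesis
    by (rule that[of "matrix g $ j"]) (use gV j g(2) in \<open>auto simp: ev\<close>)
qed

text \<open>Linear forms suffice as equations, by \<open>separating_linear_form\<close>. Hence the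
  closure in \<open>hadamard_prod\<close> adds nothing once the products of points are known to fill
  a linear space.\<close>

lemma zariski_closed_proj_space:
  assumes V: "vec.subspace V"
  shows "zariski_closed (proj_space V)"
  unfolding zariski_closed_def
proof (intro exI conjI)
  let ?S = "{F. \<exists>c. F = linear_form c \<and> (\<forall>y\<in>V. eval_hpoly F y = 0)}"
  show "\<forall>F\<in>?S. homogeneous F" using homogeneous_linear_form by auto
  have iff: "a \<in> V \<longleftrightarrow> (\<forall>F\<in>?S. eval_hpoly F a = 0)" for a
  proof (cases "a \<in> V")
    case False
    then obtain c where "\<And>y. y \<in> V \<Longrightarrow> eval_hpoly (linear_form c) y = 0"
      "eval_hpoly (linear_form c) a \<noteq> 0"
      using separating_linear_form[OF V] by blast
    then have "linear_form c \<in> ?S" "eval_hpoly (linear_form c) a \<noteq> 0" by auto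
    with False show ?thesis by meson
  qed auto
  have "zero_locus ?S = point ` {a. a \<noteq> 0 \<and> a \<in> V}" by (simp only: zero_locus_def iff)
  also have "\<dots> = proj_space V"
  proof
    show "point ` {a. a \<noteq> 0 \<and> a \<in> V} \<subseteq> proj_space V"
      using point_in_proj_space[OF V] by auto
    show "proj_space V \<subseteq> point ` {a. a \<noteq> 0 \<and> a \<in> V}"
    proof
      fix p assume "p \<in> proj_space V"
      then have "coords p \<in> {a. a \<noteq> 0 \<and> a \<in> V}" by (simp add: proj_space_def)
      from imageI[OF this, of point] show "p \<in> point ` {a. a \<noteq> 0 \<and> a \<in> V}"
        by (simp only: point_coords)
    qed
  qed
  finally show "proj_space V = zero_locus ?S" by simp
qed

lemma zariski_closure_proj_space:
  "vec.subspace V \<Longrightarrow> zariski_closure (proj_space V) = proj_space V"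
  unfolding zariski_closure_def by (intro hull_same zariski_closed_proj_space)

section \<open>Polynomials with prescribed roots\<close>

text \<open>Roots are split off one at a time: the product over the earlier roots does not vanish at
  the new one, so the cofactor must.\<close>

lemma prod_linear_factors_dvd:
  fixes f :: "'b::field poly"
  assumes "finite S" "\<And>k. k \<in> S \<Longrightarrow> poly f k = 0"
  shows "(\<Prod>k\<in>S. [:- k, 1:]) dvd f"
  using assms
proof (induction S rule: finite_induct)
  case (insert k S)
  let ?P = "\<Prod>k\<in>S. [:- k, 1:]"
  obtain g where g: "f = ?P * g" using insert by (auto elim!: dvdE)
  have "poly ?P k \<noteq> 0"
    using insert by (auto simp: poly_prod)
  with g insert.prems(1)[of k] have "poly g k = 0" by auto
  then obtain h where "g = [:- k, 1:] * h" by (auto simp: poly_eq_0_iff_dvd elim!: dvdE)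
  with g have "f = ([:- k, 1:] * ?P) * h" by (simp add: mult_ac del: mult_pCons_left mult_pCons_right)
  with insert.hyps show ?case by (simp del: mult_pCons_left mult_pCons_right)
qed simp

lemma degree_prod_linear_factors:
  "finite S \<Longrightarrow> degree (\<Prod>k\<in>S. [:- k, 1:] :: 'b::field poly) = card S"
  by (subst degree_prod_sum_eq) auto

lemma prod_linear_factors_nonzero: "(\<Prod>k\<in>S. [:- k, 1:] :: 'b::field poly) \<noteq> 0"
  by (cases "finite S") auto

lemma poly_prod_linear_factors_eq_0:
  "finite S \<Longrightarrow> poly (\<Prod>k\<in>S. [:- k, 1:] :: 'b::field poly) y = 0 \<longleftrightarrow> y \<in> S"
  by (auto simp: poly_prod)

lemma degree_le_1E:
  assumes "degree f \<le> 1"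
  obtains c d where "f = [:c, d:]"
proof -
  obtain c g where f: "f = pCons c g" by (rule pCons_cases)
  with assms have "degree g = 0" by (simp split: if_splits)
  then obtain d where "g = [:d:]" by (rule degree_eq_zeroE)
  with f that show thesis by blast
qed

text \<open>Below degree \<open>Suc r\<close> the factor \<open>l\<close> can be the constant 1,
  which as a binary linear form has its root at infinity. Otherwise \<open>f\<close> is nonconstant
  and has a complex root.\<close>

lemma complex_poly_factor_linear:
  fixes f :: "complex poly"
  assumes "degree f \<le> Suc r" "f \<noteq> 0"
  obtains l g where "f = l * g" "degree l \<le> 1" "degree g \<le> r"
proof (cases "degree f \<le> r")
  case True
  then show ?thesis using that[of 1 f] by simp
next
  case False
  then have "\<not> constant (poly f)" by (simp add: constant_degree)
  then obtain z where "poly f z = 0" using fundamental_theorem_of_algebra by blast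
  then obtain g where g: "f = [:- z, 1:] * g" by (auto simp: poly_eq_0_iff_dvd elim!: dvdE)
  with assms(2) have "degree f = 1 + degree g" by (auto simp: degree_mult_eq simp del: mult_pCons_left)
  with g assms(1) show ?thesis using that[of "[:- z, 1:]" g] by simp
qed

section \<open>Parametrised lines\<close>

text \<open>Stands for the line spanned by the vectors with coordinates v_i and x_i v_i. As the x_i
  are distinct, c + d x_i vanishes for at most one i unless c = d = 0, so a point of the line has at
  most one zero coordinate.\<close>

locale parametrised_line =
  fixes v x :: "complex ^ 'n::finite"
  assumes v_nonzero: "\<And>i. v $ i \<noteq> 0"
    and x_inj: "inj (\<lambda>i. x $ i)"
begin

text \<open>The binary form \<open>\<Sum>k\<le>r. c\<^sub>k X\<^sup>k Y\<^sup>r\<^sup>-\<^sup>k\<close>, dehomogenised as the polynomial \<open>f\<close> of degree at most \<open>r\<close>,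
  evaluated at the points \<open>(x\<^sub>i v\<^sub>i, v\<^sub>i)\<close>.\<close>

definition ev :: "nat \<Rightarrow> complex poly \<Rightarrow> complex ^ 'n" where
  "ev r f = (\<chi> i. v $ i ^ r * poly f (x $ i))"

lemma ev_nth: "ev r f $ i = v $ i ^ r * poly f (x $ i)"
  by (simp add: ev_def)

lemma ev_0 [simp]: "ev r 0 = 0"
  by (simp add: vec_eq_iff ev_nth)

lemma ev_add: "ev r (f + g) = ev r f + ev r g"
  by (simp add: vec_eq_iff ev_nth algebra_simps)

lemma ev_diff: "ev r (f - g) = ev r f - ev r g"
  by (simp add: vec_eq_iff ev_nth algebra_simps)

lemma ev_smult: "ev r (smult c f) = c *s ev r f"
  by (simp add: vec_eq_iff ev_nth)

lemma ev_sum: "ev r (\<Sum>k\<in>K. f k) = (\<Sum>k\<in>K. ev r (f k))"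
  by (induction K rule: infinite_finite_induct) (auto simp: ev_add)

lemma ev_mult: "(\<chi> i. ev r f $ i * ev s g $ i) = ev (r + s) (f * g)"
  by (simp add: vec_eq_iff ev_nth power_add)

text \<open>A nonzero polynomial of degree below \<open>CARD('n)\<close> has too few roots to vanish
  at all the distinct x_i. This is what the bound r <= n serves.\<close>

lemma ev_eq_0_iff:
  assumes "degree f < CARD('n)"
  shows "ev r f = 0 \<longleftrightarrow> f = 0"
proof
  assume "ev r f = 0"
  then have "range (\<lambda>i. x $ i) \<subseteq> {y. poly f y = 0}"
    using v_nonzero by (auto simp: vec_eq_iff ev_nth)
  then have "card (range (\<lambda>i. x $ i)) \<le> card {y. poly f y = 0}" if "f \<noteq> 0"
    using that by (intro card_mono poly_roots_finite)
  then show "f = 0"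
    using card_poly_roots_bound[of f] assms card_image[OF x_inj] by fastforce
qed simp

lemma ev_eq_iff:
  assumes "degree f < CARD('n)" "degree g < CARD('n)"
  shows "ev r f = ev r g \<longleftrightarrow> f = g"
  using ev_eq_0_iff[of "f - g" r] degree_diff_less[of f "CARD('n)" g] assms
  by (simp add: ev_diff)

text \<open>For \<open>r < CARD('n)\<close>, the empty \<open>S\<close> will give the cone over the
  r-th Hadamard power of the line, singletons the cones over the hyperplanes of the configuration,
  and larger \<open>S\<close> their intersections.\<close>

definition ev_space :: "nat \<Rightarrow> complex set \<Rightarrow> (complex ^ 'n) set" where
  "ev_space r S = ev r ` {f. degree f \<le> r \<and> (\<forall>k\<in>S. poly f k = 0)}"

lemma ev_spaceI: "degree f \<le> r \<Longrightarrow> (\<And>k. k \<in> S \<Longrightarrow> poly f k = 0) \<Longrightarrow> ev r f \<in> ev_space r S"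
  by (auto simp: ev_space_def)

lemma subspace_ev_space: "vec.subspace (ev_space r S)"
proof (rule vec.subspaceI)
  show "0 \<in> ev_space r S" using ev_spaceI[of 0 r S] by simp
next
  fix y z assume "y \<in> ev_space r S" "z \<in> ev_space r S"
  then show "y + z \<in> ev_space r S"
    by (auto simp: ev_space_def ev_add[symmetric] degree_add_le)
next
  fix c y assume "y \<in> ev_space r S"
  then show "c *s y \<in> ev_space r S"
    by (auto simp: ev_space_def ev_smult[symmetric] intro!: imageI degree_smult_le[THEN order_trans])
qed

text \<open>Each \<open>i\<close> supplies its own polynomial with values \<open>y\<close>, but by
  \<open>ev_eq_iff\<close> they are all the same one, which then vanishes on every
  \<open>S i\<close>.\<close>

lemma ev_space_Inter:
  assumes "r < CARD('n)" "J \<noteq> {}"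
  shows "(\<Inter>i\<in>J. ev_space r (S i)) = ev_space r (\<Union>i\<in>J. S i)"
proof
  show "(\<Inter>i\<in>J. ev_space r (S i)) \<subseteq> ev_space r (\<Union>i\<in>J. S i)"
  proof
    fix y assume y: "y \<in> (\<Inter>i\<in>J. ev_space r (S i))"
    obtain i0 where "i0 \<in> J" using assms(2) by blast
    with y obtain f where f: "y = ev r f" "degree f \<le> r" by (auto simp: ev_space_def)
    have "poly f k = 0" if i: "i \<in> J" "k \<in> S i" for i k
    proof -
      obtain g where g: "y = ev r g" "degree g \<le> r" "poly g k = 0"
        using y i by (auto simp: ev_space_def)
      then have "f = g" using ev_eq_iff[of f g r] f assms(1) by simp
      with g show ?thesis by simp
    qed
    with f show "y \<in> ev_space r (\<Union>i\<in>J. S i)" by (auto intro: ev_spaceI)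
  qed
qed (auto simp: ev_space_def)

text \<open>Vanishing on \<open>S\<close> is divisibility by the product of the X - k, and the
  cofactor takes up the remaining degree.\<close>

lemma ev_space_eq:
  assumes "finite S" "card S \<le> r"
  shows "ev_space r S = (\<lambda>g. ev r ((\<Prod>k\<in>S. [:- k, 1:]) * g)) ` {g. degree g \<le> r - card S}"
    (is "_ = (\<lambda>g. ev r (?P * g)) ` _")
proof
  show "ev_space r S \<subseteq> (\<lambda>g. ev r (?P * g)) ` {g. degree g \<le> r - card S}"
  proof
    fix y assume "y \<in> ev_space r S"
    then obtain f where f: "y = ev r f" "degree f \<le> r" "\<forall>k\<in>S. poly f k = 0"
      by (auto simp: ev_space_def)
    then obtain g where g: "f = ?P * g"
      using prod_linear_factors_dvd[of S f] assms(1) by (auto elim: dvdE)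
    have "degree g \<le> r - card S"
      using f(2) prod_linear_factors_nonzero[of S] degree_prod_linear_factors[OF assms(1)]
      by (cases "g = 0") (auto simp: g degree_mult_eq)
    with f g show "y \<in> (\<lambda>g. ev r (?P * g)) ` {g. degree g \<le> r - card S}" by auto
  qed
  show "(\<lambda>g. ev r (?P * g)) ` {g. degree g \<le> r - card S} \<subseteq> ev_space r S"
  proof clarify
    fix g :: "complex poly" assume "degree g \<le> r - card S"
    then have "degree (?P * g) \<le> r"
      using degree_mult_le[of ?P g] assms degree_prod_linear_factors[OF assms(1)] by simp
    then show "ev r (?P * g) \<in> ev_space r S"
      using poly_prod_linear_factors_eq_0[OF assms(1)] by (auto intro: ev_spaceI)
  qed
qed

lemma ev_space_trivial:
  assumes "finite S" "r < card S"
  shows "ev_space r S = {0}"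
proof -
  have "f = 0" if "degree f \<le> r" "\<forall>k\<in>S. poly f k = 0" for f
  proof (rule ccontr)
    assume "f \<noteq> 0"
    then have "card S \<le> card {y. poly f y = 0}"
      using that by (intro card_mono poly_roots_finite) auto
    with card_poly_roots_bound[OF \<open>f \<noteq> 0\<close>] that assms show False by simp
  qed
  then have "{f. degree f \<le> r \<and> (\<forall>k\<in>S. poly f k = 0)} = {0}" by auto
  then show ?thesis by (simp add: ev_space_def)
qed

text \<open>Sending \<open>g\<close> to \<open>ev r (P * g)\<close> is linear, and injective in
  degree at most \<open>d\<close>, so it carries the monomials up to X^d to a basis.\<close>

lemma dim_ev_space:
  assumes "finite S" "card S \<le> r" "r < CARD('n)"
  shows "vec.dim (ev_space r S) = r - card S + 1"
proof -
  define d where "d = r - card S"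
  define P where "P = (\<Prod>k\<in>S. [:- k, 1:] :: complex poly)"
  define b where "b k = ev r (P * monom 1 k)" for k
  have P: "P \<noteq> 0" "degree P + d = r"
    using assms prod_linear_factors_nonzero[of S] degree_prod_linear_factors[of S]
    by (auto simp: P_def d_def)
  have space: "ev_space r S = (\<lambda>g. ev r (P * g)) ` {g. degree g \<le> d}"
    using ev_space_eq[OF assms(1,2)] by (simp add: P_def d_def)
  have inj: "g = h" if "ev r (P * g) = ev r (P * h)" "degree g \<le> d" "degree h \<le> d" for g h
    using ev_eq_iff[of "P * g" "P * h" r] that P assms(3) degree_mult_le[of P g] degree_mult_le[of P h]
    by simp
  \<comment> \<open>Through this identity both spanning and independence become statements about the
    coefficients of a polynomial.\<close>
  have comb: "(\<Sum>k\<le>d. c k *s b k) = ev r (P * (\<Sum>k\<le>d. monom (c k) k))" for c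
  proof -
    have "c k *s b k = ev r (P * monom (c k) k)" for k
      by (simp add: b_def flip: ev_smult mult_smult_right) (simp add: smult_monom)
    then show ?thesis by (simp add: sum_distrib_left ev_sum)
  qed
  have degsum: "degree (\<Sum>k\<le>d. monom (c k) k) \<le> d" for c :: "nat \<Rightarrow> complex"
    by (intro degree_sum_le) (auto intro: degree_monom_le[THEN order_trans])
  have inj_b: "inj_on b {..d}"
  proof (rule inj_onI)
    fix k l assume "k \<in> {..d}" "l \<in> {..d}" "b k = b l"
    then have "monom (1::complex) k = monom 1 l"
      by (intro inj) (auto simp: b_def degree_monom_eq)
    then show "k = l" by (simp add: monom_eq_iff')
  qed
  show ?thesis
  proof (rule vec.dim_unique)
    show "b ` {..d} \<subseteq> ev_space r S"
      unfolding space b_def by (auto simp: degree_monom_eq)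
    show "ev_space r S \<subseteq> vec.span (b ` {..d})"
    proof
      fix y assume "y \<in> ev_space r S"
      then obtain g where g: "y = ev r (P * g)" "degree g \<le> d" by (auto simp: space)
      then have "y = (\<Sum>k\<le>d. coeff g k *s b k)"
        using comb[of "coeff g"] by (simp add: poly_as_sum_of_monoms')
      moreover have "coeff g k *s b k \<in> vec.span (b ` {..d})" if "k \<in> {..d}" for k
        by (rule vec.span_scale, rule vec.span_base, rule imageI, rule that)
      ultimately show "y \<in> vec.span (b ` {..d})"
        using vec.span_sum[of "{..d}" "\<lambda>k. coeff g k *s b k"] by metis
    qed
    show "vec.independent (b ` {..d})"
    proof (rule vec.independent_if_scalars_zero)
      fix c y assume "(\<Sum>y\<in>b ` {..d}. c y *s y) = 0" and y: "y \<in> b ` {..d}"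
      \<comment> \<open>The scalars \<open>c\<close> are attached to vectors; injectivity of
        \<open>b\<close> makes them the coefficients of a single polynomial, which then has to be
        0.\<close>
      then have "ev r (P * (\<Sum>k\<le>d. monom (c (b k)) k)) = ev r (P * 0)"
        using inj_b by (simp add: sum.reindex comb[of "\<lambda>k. c (b k)"])
      then have z: "(\<Sum>k\<le>d. monom (c (b k)) k) = 0"
        by (rule inj) (simp_all add: degsum)
      obtain l where l: "y = b l" "l \<le> d" using y by auto
      have "coeff (\<Sum>k\<le>d. monom (c (b k)) k) l = c (b l)"
        using l by (simp add: coeff_sum)
      with z l show "c y = 0" by simp
    qed simp
    show "card (b ` {..d}) = r - card S + 1"
      using inj_b by (simp add: card_image d_def)
  qed
qed

text \<open>With \<open>card S = r\<close> the cofactor in \<open>ev_space_eq\<close> is constant.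
  The case r = 0 also identifies the zeroth Hadamard power.\<close>

lemma proj_space_ev_space_singleton:
  assumes "finite S" "card S = r" "r < CARD('n)"
  shows "proj_space (ev_space r S) = {point (ev r (\<Prod>k\<in>S. [:- k, 1:]))}"
proof -
  let ?P = "\<Prod>k\<in>S. [:- k, 1:]"
  have nz: "ev r ?P \<noteq> 0"
    using ev_eq_0_iff[of ?P r] prod_linear_factors_nonzero[of S]
      degree_prod_linear_factors[of S] assms by simp
  have "p = point (ev r ?P)" if p: "coords p \<in> ev_space r S" for p
  proof -
    obtain g where g: "coords p = ev r (?P * g)" "degree g = 0"
      using p assms by (auto simp: ev_space_eq)
    then obtain c where "g = [:c:]" using degree_eq_zeroE by blast
    with g have c: "coords p = c *s ev r ?P" by (simp add: ev_smult)
    then have "c \<noteq> 0" using coords_nonzero[of p] by auto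
    then have "point (ev r ?P) = point (coords p)" using c nz by (subst point_eq_iff) auto
    then show ?thesis by simp
  qed
  moreover have "ev r ?P \<in> ev_space r S"
    using ev_space_eq[of S r] assms by (auto intro!: image_eqI[of _ _ 1])
  then have "point (ev r ?P) \<in> proj_space (ev_space r S)"
    using point_in_proj_space[OF subspace_ev_space nz] by simp
  ultimately show ?thesis unfolding proj_space_def by blast
qed

text \<open>The product of nonzero polynomials is nonzero, and its degree is small enough for
  \<open>ev\<close> not to kill it; so these Hadamard products are always defined.\<close>

lemma hadamard_ev:
  assumes "f \<noteq> 0" "g \<noteq> 0" "degree f \<le> r" "degree g \<le> s" "r + s < CARD('n)"
  shows "hadamard (point (ev r f)) (point (ev s g)) = Some (point (ev (r + s) (f * g)))"
proof -
  have "ev r f \<noteq> 0" "ev s g \<noteq> 0" "ev (r + s) (f * g) \<noteq> 0"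
    using assms degree_mult_le[of f g] by (auto simp: ev_eq_0_iff)
  then show ?thesis by (simp add: hadamard_point ev_mult)
qed

lemma in_proj_space_ev_space_iff:
  assumes "r < CARD('n)"
  shows "p \<in> proj_space (ev_space r {}) \<longleftrightarrow> (\<exists>f. f \<noteq> 0 \<and> degree f \<le> r \<and> p = point (ev r f))"
proof
  assume "p \<in> proj_space (ev_space r {})"
  then obtain f where f: "coords p = ev r f" "degree f \<le> r"
    by (auto simp: proj_space_def ev_space_def)
  then have "f \<noteq> 0" using coords_nonzero[of p] by auto
  with f show "\<exists>f. f \<noteq> 0 \<and> degree f \<le> r \<and> p = point (ev r f)" by (metis point_coords)
next
  assume "\<exists>f. f \<noteq> 0 \<and> degree f \<le> r \<and> p = point (ev r f)"
  then show "p \<in> proj_space (ev_space r {})"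
    using assms point_in_proj_space[OF subspace_ev_space] ev_eq_0_iff ev_spaceI
    by (metis empty_iff le_less_trans)
qed

text \<open>Products of polynomials respect the degree bound; conversely, a factor of degree at most
  1 splits off by \<open>complex_poly_factor_linear\<close>. So the products fill a linear space
  before any closure is taken.\<close>

lemma hadamard_power_line:
  assumes "r < CARD('n)"
  shows "hadamard_power (proj_space (ev_space 1 {})) r = proj_space (ev_space r {})"
  using assms
proof (induction r)
  case 0
  have "ev 0 1 = vec 1" by (simp add: vec_eq_iff ev_nth)
  then show ?case using proj_space_ev_space_singleton[of "{}" 0] by simp
next
  case (Suc r)
  let ?L = "proj_space (ev_space 1 {})" and ?M = "proj_space (ev_space r {})"
  have "{s. \<exists>p\<in>?L. \<exists>q\<in>?M. hadamard p q = Some s} = proj_space (ev_space (Suc r) {})"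
    (is "?A = ?B")
  proof (intro set_eqI iffI)
    fix s assume "s \<in> ?A"
    then obtain p q where pq: "p \<in> ?L" "q \<in> ?M" "hadamard p q = Some s" by blast
    obtain f where f: "f \<noteq> 0" "degree f \<le> 1" "p = point (ev 1 f)"
      using pq(1) Suc.prems by (auto simp: in_proj_space_ev_space_iff)
    obtain g where g: "g \<noteq> 0" "degree g \<le> r" "q = point (ev r g)"
      using pq(2) Suc.prems by (auto simp: in_proj_space_ev_space_iff)
    have "s = point (ev (Suc r) (f * g))"
      using hadamard_ev[of f g 1 r] f g pq(3) Suc.prems by simp
    moreover have "degree (f * g) \<le> Suc r" using degree_mult_le[of f g] f g by simp
    ultimately show "s \<in> ?B"
      using f g Suc.prems by (auto simp: in_proj_space_ev_space_iff intro!: exI[of _ "f * g"])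
  next
    fix s assume "s \<in> ?B"
    then obtain h where h: "h \<noteq> 0" "degree h \<le> Suc r" "s = point (ev (Suc r) h)"
      using Suc.prems by (auto simp: in_proj_space_ev_space_iff)
    obtain f g where fg: "h = f * g" "degree f \<le> 1" "degree g \<le> r"
      using complex_poly_factor_linear[OF h(2,1)] .
    then have "hadamard (point (ev 1 f)) (point (ev r g)) = Some s"
      using h hadamard_ev[of f g 1 r] Suc.prems by auto
    moreover have "point (ev 1 f) \<in> ?L" "point (ev r g) \<in> ?M"
      using fg h(1) Suc.prems by (auto simp: in_proj_space_ev_space_iff)
    ultimately show "s \<in> ?A" by blast
  qed
  then show ?case
    using Suc by (simp add: hadamard_prod_def zariski_closure_proj_space subspace_ev_space)
qed

text \<open>Injectivity of \<open>a\<close> on the list turns the product over the list into one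
  over the set of roots.\<close>

lemma hadamard_list_line:
  assumes "distinct ps" "inj_on a (set ps)" "length ps < CARD('n)"
    and "\<And>p. p \<in> set ps \<Longrightarrow> p = point (ev 1 [:- a p, 1:])"
  shows "hadamard_list ps = Some (point (ev (length ps) (\<Prod>k\<in>a ` set ps. [:- k, 1:])))"
  using assms
proof (induction ps)
  case Nil
  have "ev 0 1 = vec 1" by (simp add: vec_eq_iff ev_nth)
  then show ?case by simp
next
  case (Cons p ps)
  let ?P = "\<Prod>k\<in>a ` set ps. [:- k, 1:]"
  have IH: "hadamard_list ps = Some (point (ev (length ps) ?P))"
    using Cons by auto
  have "degree ?P \<le> length ps"
    using degree_prod_linear_factors[of "a ` set ps"] card_image_le[of "set ps" a]
      card_length[of ps] by simp
  then have "hadamard (point (ev 1 [:- a p, 1:])) (point (ev (length ps) ?P))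
      = Some (point (ev (1 + length ps) ([:- a p, 1:] * ?P)))"
    using Cons.prems prod_linear_factors_nonzero by (intro hadamard_ev) auto
  \<comment> \<open>Hence the product over the enlarged set of roots gains exactly one
    factor.\<close>
  moreover have "a p \<notin> a ` set ps" using Cons.prems by auto
  ultimately show ?case
    using IH Cons.prems(4)[of p] by (simp del: mult_pCons_left)
qed

end

section \<open>Parametrising a line on which no point has two zero coordinates\<close>

lemma line_coordinates_nonzero:
  fixes V :: "(complex ^ 'n::finite) set"
  assumes "CARD('n) = n + 1" "proj_space V \<inter> Delta (int n - 2) = {}" "vec.subspace V"
    and "a \<in> V" "a \<noteq> 0" "a $ i = 0" "a $ j = 0"
  shows "i = j"
proof (rule ccontr)
  assume "i \<noteq> j"
  have "{k. a $ k \<noteq> 0} \<subseteq> UNIV - {i, j}" using assms by auto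
  then have "card {k. a $ k \<noteq> 0} \<le> card (UNIV - {i, j})" by (intro card_mono) auto
  also have "\<dots> = CARD('n) - 2" using \<open>i \<noteq> j\<close> by (subst card_Diff_subset) auto
  finally have "card {k. a $ k \<noteq> 0} \<le> n - 1" using assms(1) by simp
  \<comment> \<open>Two distinct indices force n >= 1, so the truncated \<open>n - 1\<close> agrees
    with the bound (n - 2) + 1 in \<open>Delta\<close>.\<close>
  moreover have "2 \<le> CARD('n)"
    using card_mono[of UNIV "{i, j}"] \<open>i \<noteq> j\<close> by simp
  ultimately have "point a \<in> Delta (int n - 2)"
    using assms(1,5) by (simp add: Delta_def nonzero_coords_point)
  moreover have "point a \<in> proj_space V" using assms by (simp add: point_in_proj_space)
  ultimately show False using assms(2) by blast
qed

text \<open>The vector \<open>v\<close> is picked among the a + t b for a basis a, b: each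
  coordinate and each point of \<open>Z\<close> rules out at most one parameter t, so some t
  remains.\<close>

lemma line_parametrisation:
  fixes L Z :: "'n::finite proj set"
  assumes card: "CARD('n) = n + 1" and n: "1 \<le> n"
    and L: "linear_space L" "linear_dim L = 1" "L \<inter> Delta (int n - 2) = {}"
    and Z: "finite Z"
  obtains v x where "parametrised_line v x"
    "L = proj_space (parametrised_line.ev_space v x 1 {})" "point v \<notin> Z"
proof -
  define V where "V = affine_cone L"
  have V: "vec.subspace V" "vec.dim V = 2" "L = proj_space V"
    using L by (auto simp: V_def linear_space_def linear_dim_def proj_space_affine_cone)
  note zeros = line_coordinates_nonzero[OF card _ V(1), folded V(3), OF L(3)]
  obtain B where B: "B \<subseteq> V" "vec.independent B" "V \<subseteq> vec.span B" "card B = 2"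
    using vec.basis_exists[of V] V(2) by metis
  then obtain a b where ab: "B = {a, b}" "a \<noteq> b" by (auto simp: card_2_iff)
  have indep: "s = 0 \<and> t = 0" if "s *s a + t *s b = 0" for s t
  proof -
    have a: "a \<notin> vec.span {b}" and b: "b \<noteq> 0"
      using B(2) ab by (auto simp: vec.independent_insert)
    have "s = 0"
    proof (rule ccontr)
      assume "s \<noteq> 0"
      have "s *s a = (- t) *s b" using that by (simp add: eq_neg_iff_add_eq_0)
      then have "a = (- t / s) *s b" using \<open>s \<noteq> 0\<close> by (simp add: vec_eq_iff field_simps)
      with a show False by (metis vec.span_base vec.span_scale singletonI)
    qed
    with that b show ?thesis by simp
  qed
  have comb: "s *s a + t *s b \<in> V" for s t
    using B(1) ab V(1) by (auto intro!: vec.subspace_add vec.subspace_scale)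
  have span: "\<exists>s t. y = s *s a + t *s b" if "y \<in> V" for y
  proof -
    have "y \<in> vec.span (insert a {b})" using that B(3) ab by auto
    then obtain s where "y - s *s a \<in> vec.span {b}" by (auto simp: vec.span_breakdown_eq)
    then obtain t where "y - s *s a = t *s b" by (auto simp: vec.span_singleton)
    then show ?thesis by (metis diff_add_cancel add.commute)
  qed
  \<comment> \<open>These vectors represent all points of the line except
    \<open>point b\<close>.\<close>
  define w where "w t = a + t *s b" for t
  have w: "w t \<in> V" "w t \<noteq> 0" for t
    using comb[of 1 t] indep[of 1 t] by (auto simp: w_def)
  have "inj (\<lambda>t. point (w t))"
  proof (rule injI)
    fix s t assume "point (w s) = point (w t)"
    then obtain c where "w t = c *s w s" using w by (auto simp: point_eq_iff)
    then have "(1 - c) *s a + (t - c * s) *s b = 0"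
      by (simp add: w_def vec_eq_iff algebra_simps)
    then show "s = t" using indep by fastforce
  qed
  then have fin_Z: "finite ((\<lambda>t. point (w t)) -` Z)" using Z by (simp add: finite_vimageI)
  have "finite {t. w t $ i = 0}" for i
  proof -
    have "s = t" if "w s $ i = 0" "w t $ i = 0" for s t
    proof (rule ccontr)
      assume "s \<noteq> t"
      \<comment> \<open>A coordinate that vanishes at two parameters vanishes on all of
        \<open>V\<close>.\<close>
      have "(s - t) * b $ i = w s $ i - w t $ i" by (simp add: w_def algebra_simps)
      with that \<open>s \<noteq> t\<close> have bi: "b $ i = 0" by simp
      with that have ai: "a $ i = 0" by (simp add: w_def)
      obtain j where "j \<noteq> i"
      proof -
        have "UNIV \<noteq> {i}"
        proof
          assume "UNIV = {i}"
          then have "CARD('n) = card {i}" by (rule arg_cong)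
          with card n show False by simp
        qed
        with that show thesis by blast
      qed
      \<comment> \<open>This combination vanishes at \<open>j\<close> as well as at
        \<open>i\<close>, so it must be 0. Independence then makes a_j zero, and \<open>a\<close>
        itself has two zero coordinates.\<close>
      define y where "y = b $ j *s a + (- a $ j) *s b"
      have "y $ i = 0" "y $ j = 0" using ai bi by (auto simp: y_def)
      moreover have "y \<in> V" unfolding y_def by (rule comb)
      ultimately have "y = 0" using zeros[of y i j] \<open>j \<noteq> i\<close> by auto
      then have "a $ j = 0" using indep[of "b $ j" "- a $ j"] by (simp add: y_def)
      with zeros[of a i j] ai \<open>j \<noteq> i\<close> B(1) ab have "a = 0" by auto
      with indep[of 1 0] show False by simp
    qed
    then have "is_singleton {t. w t $ i = 0} \<or> {t. w t $ i = 0} = {}"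
      by (auto intro!: is_singletonI')
    then show ?thesis by (auto simp: is_singleton_def)
  qed
  then have "finite ((\<Union>i. {t. w t $ i = 0}) \<union> (\<lambda>t. point (w t)) -` Z)"
    using fin_Z by auto
  then obtain t where t: "t \<notin> (\<Union>i. {t. w t $ i = 0}) \<union> (\<lambda>t. point (w t)) -` Z"
    using ex_new_if_finite[OF infinite_UNIV_char_0] by metis
  define v where "v = w t"
  define x where "x = (\<chi> i. b $ i / v $ i)"
  have v: "v $ i \<noteq> 0" for i using t by (auto simp: v_def)
  interpret parametrised_line v x
  proof
    show "v $ i \<noteq> 0" for i by (rule v)
    show "inj (\<lambda>i. x $ i)"
    proof (rule injI)
      fix i j assume eq: "x $ i = x $ j"
      \<comment> \<open>This is b - x_i v in the basis a, b, as v = a + t b. It vanishes at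
        \<open>i\<close> and \<open>j\<close>, while its two coefficients cannot both be 0.\<close>
      define y where "y = (- x $ i) *s a + (1 - x $ i * t) *s b"
      have y: "y $ k = b $ k - x $ i * v $ k" for k
        by (simp add: y_def v_def w_def algebra_simps)
      have "y $ i = 0" using v[of i] unfolding y by (simp add: x_def)
      moreover have "y $ j = 0" using v[of j] unfolding y eq by (simp add: x_def)
      moreover have "y \<noteq> 0"
        using indep[of "- x $ i" "1 - x $ i * t"] unfolding y_def[symmetric] by auto
      moreover have "y \<in> V" unfolding y_def by (rule comb)
      ultimately show "i = j" using zeros[of y] by blast
    qed
  qed
  \<comment> \<open>Since x_i v_i = b_i, polynomials of degree at most 1 give all combinations of
    \<open>v\<close> and \<open>b\<close>, which span \<open>V\<close>.\<close>
  have ev1: "ev 1 [:c, d:] = c *s v + d *s b" for c d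
    unfolding vec_eq_iff ev_nth using v by (simp add: x_def field_simps)
  have "ev_space 1 {} = V"
  proof
    show "ev_space 1 {} \<subseteq> V"
    proof
      fix y assume "y \<in> ev_space 1 {}"
      then obtain f where f: "y = ev 1 f" "degree f \<le> 1" by (auto simp: ev_space_def)
      then obtain c d where "f = [:c, d:]" using degree_le_1E by blast
      with f ev1 have "y = c *s a + (c * t + d) *s b"
        by (simp add: v_def w_def vec_eq_iff algebra_simps)
      then show "y \<in> V" using comb[of c "c * t + d"] by (simp only:)
    qed
    show "V \<subseteq> ev_space 1 {}"
    proof
      fix y assume "y \<in> V"
      then obtain c d where "y = c *s a + d *s b" using span by blast
      then have "y = ev 1 [:c, d - c * t:]"
        unfolding ev1 by (simp add: v_def w_def vec_eq_iff algebra_simps)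
      then show "y \<in> ev_space 1 {}" by (auto intro!: ev_spaceI)
    qed
  qed
  then show thesis
    using that[of v x] parametrised_line_axioms V(3) t by (auto simp: v_def)
qed

section \<open>The star configuration\<close>

theorem theorem4p7:
  fixes L Z :: "'n::finite proj set" and n m r :: nat
  assumes "CARD('n) = n + 1"
    and "linear_space L" and "linear_dim L = 1"
    and "Z \<subseteq> L" and "finite Z" and "card Z = m"
    and "1 \<le> r" and "r \<le> min m n"
    and "L \<inter> Delta (int n - 2) = {}"
    and "Z \<inter> Delta (int n - 1) = {}"
  shows "star_configuration m r (hadamard_power L r) (sqfree_hadamard_power Z r)"
proof -
  obtain v x where vx: "parametrised_line v x"
    and L: "L = proj_space (parametrised_line.ev_space v x 1 {})" and vZ: "point v \<notin> Z"
    using line_parametrisation[OF assms(1) _ assms(2,3,9,5)] assms(7,8) by auto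
  interpret parametrised_line v x by (rule vx)
  have r: "1 < CARD('n)" "r < CARD('n)" using assms(1,7,8) by auto
  have M: "hadamard_power L r = proj_space (ev_space r {})"
    unfolding L by (rule hadamard_power_line[OF r(2)])
  have v0: "v \<noteq> 0" using v_nonzero by auto
  \<comment> \<open>A constant polynomial would give \<open>point v\<close>, which is not in
    \<open>Z\<close>. So the linear coefficient is nonzero and can be scaled to 1.\<close>
  have "\<exists>k. p = point (ev 1 [:- k, 1:])" if p: "p \<in> Z" for p
  proof -
    obtain f where f: "f \<noteq> 0" "degree f \<le> 1" "p = point (ev 1 f)"
      using p assms(4) L in_proj_space_ev_space_iff[OF r(1)] by auto
    then obtain c d where cd: "f = [:c, d:]" using degree_le_1E by blast
    have "d \<noteq> 0"
    proof
      assume "d = 0"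
      with cd have "ev 1 f = c *s v" by (simp add: vec_eq_iff ev_nth)
      moreover have "c \<noteq> 0" using \<open>d = 0\<close> cd f(1) by auto
      ultimately have "point v = p" using f(3) v0 by (subst f(3), subst point_eq_iff) auto
      with p vZ show False by simp
    qed
    then have "f = smult d [:- (- c / d), 1:]" using cd by simp
    then have "ev 1 f = d *s ev 1 [:- (- c / d), 1:]" by (simp only: ev_smult)
    moreover have "ev 1 f \<noteq> 0" using ev_eq_0_iff[of f 1] f(1,2) r(1) by simp
    ultimately have "point (ev 1 [:- (- c / d), 1:]) = p"
      using \<open>d \<noteq> 0\<close> unfolding f(3) by (subst point_eq_iff) auto
    then show ?thesis by blast
  qed
  then obtain a where a: "\<And>p. p \<in> Z \<Longrightarrow> p = point (ev 1 [:- a p, 1:])" by metis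
  \<comment> \<open>The equation for \<open>a\<close> recovers a point from its root.\<close>
  have inj_a: "inj_on a Z" using a by (metis inj_onI)
  \<comment> \<open>For an \<open>r\<close>-element set of roots this is both the Hadamard product
    of their points and the common point of their hyperplanes.\<close>
  define pt where "pt S = point (ev r (\<Prod>k\<in>S. [:- k, 1:]))" for S
  have pt: "proj_space (ev_space r S) = {pt S}" if "finite S" "card S = r" for S
    unfolding pt_def by (rule proj_space_ev_space_singleton[OF that r(2)])
  define R where "R = a ` Z"
  have R: "finite R" "card R = m"
    using assms(5,6) inj_a by (auto simp: R_def card_image)
  define \<S> where "\<S> = {S. S \<subseteq> R \<and> card S = r}"
  have fin: "finite S" if "S \<in> \<S>" for S using that R(1) by (auto simp: \<S>_def intro: finite_subset)
  have X: "sqfree_hadamard_power Z r = pt ` \<S>"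
  proof (intro set_eqI iffI)
    fix s assume "s \<in> sqfree_hadamard_power Z r"
    then obtain ps where ps: "length ps = r" "distinct ps" "set ps \<subseteq> Z" "hadamard_list ps = Some s"
      by (auto simp: sqfree_hadamard_power_def)
    have inj: "inj_on a (set ps)" using inj_a ps(3) by (rule inj_on_subset)
    have "s = pt (a ` set ps)"
      using hadamard_list_line[OF ps(2) inj] ps a r(2) by (auto simp: pt_def)
    moreover have "a ` set ps \<in> \<S>"
      using ps inj by (auto simp: \<S>_def R_def card_image distinct_card)
    ultimately show "s \<in> pt ` \<S>" by blast
  next
    fix s assume "s \<in> pt ` \<S>"
    then obtain S where S: "S \<subseteq> R" "card S = r" "s = pt S" by (auto simp: \<S>_def)
    then obtain T where T: "T \<subseteq> Z" "S = a ` T" by (auto simp: R_def subset_image_iff)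
    have inj: "inj_on a T" using inj_a T(1) by (rule inj_on_subset)
    obtain ps where ps: "set ps = T" "distinct ps"
      using finite_distinct_list[of T] T(1) assms(5) finite_subset by metis
    have "length ps = r" using ps S T inj by (metis card_image distinct_card)
    then have "hadamard_list ps = Some s"
      using hadamard_list_line[OF ps(2), of a] ps inj T a r(2) S(3) by (auto simp: pt_def)
    then show "s \<in> sqfree_hadamard_power Z r"
      using ps T(1) \<open>length ps = r\<close> by (auto simp: sqfree_hadamard_power_def)
  qed
  \<comment> \<open>Gives the count \<open>m choose r\<close>. A point common to \<open>S\<close>
    and \<open>T\<close> comes from a nonzero polynomial vanishing on their union, which therefore
    has at most \<open>r\<close> elements and equals both.\<close>
  have inj_pt: "inj_on pt \<S>"
  proof (rule inj_onI)
    fix S T assume ST: "S \<in> \<S>" "T \<in> \<S>" "pt S = pt T"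
    have "finite S" "finite T" by (rule fin[OF ST(1)], rule fin[OF ST(2)])
    have "card S = r" "card T = r" using ST(1,2) unfolding \<S>_def by blast+
    have "pt S \<in> proj_space (ev_space r S)"
      unfolding pt[OF \<open>finite S\<close> \<open>card S = r\<close>] by (rule singletonI)
    moreover have "pt S \<in> proj_space (ev_space r T)"
      unfolding pt[OF \<open>finite T\<close> \<open>card T = r\<close>] ST(3) by (rule singletonI)
    ultimately have "coords (pt S) \<in> ev_space r (S \<union> T)"
      using ev_space_Inter[OF r(2), of "{S, T}" id] by (auto simp: proj_space_def)
    then have "ev_space r (S \<union> T) \<noteq> {0}" using coords_nonzero by blast
    then have "card (S \<union> T) \<le> r"
      using ev_space_trivial[of "S \<union> T" r] \<open>finite S\<close> \<open>finite T\<close> by auto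
    then have "S = S \<union> T" "T = S \<union> T"
      using card_seteq[of "S \<union> T" S] card_seteq[of "S \<union> T" T]
        \<open>card S = r\<close> \<open>card T = r\<close> \<open>finite S\<close> \<open>finite T\<close> by auto
    then show "S = T" by simp
  qed
  obtain z where z: "bij_betw z {1..m} R"
    using finite_same_card_bij[of "{1..m}" R] R by auto
  define H where "H i = proj_space (ev_space r {z i})" for i
  have Hint: "(\<Inter>i\<in>J. H i) = proj_space (ev_space r (z ` J))" if "J \<noteq> {}" for J
    unfolding H_def using that r(2) by (simp add: ev_space_Inter UNION_singleton_eq_range flip: proj_space_Inter)
  have zJ: "finite (z ` J)" "card (z ` J) = card J" "z ` J \<subseteq> R" if "J \<subseteq> {1..m}" for J
    using that z bij_betw_subset[OF z that refl]
    by (auto simp: bij_betw_def card_image finite_subset)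
  have "linear_general_position m r H (proj_space (ev_space r {}))"
    unfolding linear_general_position_def
  proof (intro conjI ballI allI impI)
    show "linear_space (proj_space (ev_space r {}))"
      by (simp add: linear_space_proj_space subspace_ev_space)
    show "linear_dim (proj_space (ev_space r {})) = int r"
      using dim_ev_space[of "{}" r] r(2) by (simp add: linear_dim_proj_space subspace_ev_space)
  next
    fix i assume "i \<in> {1..m}"
    show "linear_space (H i)" by (simp add: H_def linear_space_proj_space subspace_ev_space)
    show "H i \<subseteq> proj_space (ev_space r {})" by (auto simp: H_def proj_space_def ev_space_def)
    show "linear_dim (H i) + 1 = int r"
      using dim_ev_space[of "{z i}" r] r(2) assms(7)
      by (simp add: H_def linear_dim_proj_space subspace_ev_space)
  next
    fix J assume J: "J \<subseteq> {1..m} \<and> J \<noteq> {}" and le: "card J \<le> r"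
    \<comment> \<open>The \<open>+ 1\<close> in \<open>dim_ev_space\<close> cancels the
      \<open>- 1\<close> in \<open>linear_dim\<close>.\<close>
    show "linear_dim (\<Inter>i\<in>J. H i) = int r - int (card J)"
      using dim_ev_space[of "z ` J" r] zJ[of J] J le r(2)
      by (simp add: Hint linear_dim_proj_space subspace_ev_space of_nat_diff)
  next
    fix J assume J: "J \<subseteq> {1..m} \<and> J \<noteq> {}" and le: "r < card J"
    \<comment> \<open>Only the zero vector is left, and no point has it as coordinates.\<close>
    show "(\<Inter>i\<in>J. H i) = {}"
      using ev_space_trivial[of "z ` J" r] zJ[of J] J le by (auto simp: Hint proj_space_def)
  qed
  moreover have "pt ` \<S> = (\<Union>J\<in>{J. J \<subseteq> {1..m} \<and> card J = r}. \<Inter>i\<in>J. H i)"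
  proof -
    \<comment> \<open>Here \<open>1 <= r\<close> makes \<open>J\<close> nonempty, as
      \<open>Hint\<close> requires.\<close>
    have "(\<Inter>i\<in>J. H i) = {pt (z ` J)}" if "J \<subseteq> {1..m}" "card J = r" for J
      using Hint[of J] pt[of "z ` J"] zJ[OF that(1)] that assms(7) by fastforce
    moreover have "\<S> = (`) z ` {J. J \<subseteq> {1..m} \<and> card J = r}"
    proof
      show "\<S> \<subseteq> (`) z ` {J. J \<subseteq> {1..m} \<and> card J = r}"
      proof
        fix S assume S: "S \<in> \<S>"
        then obtain J where J: "J \<subseteq> {1..m}" "S = z ` J"
          using z by (auto simp: \<S>_def bij_betw_def subset_image_iff)
        with S zJ[OF J(1)] show "S \<in> (`) z ` {J. J \<subseteq> {1..m} \<and> card J = r}"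
          by (auto simp: \<S>_def)
      qed
      show "(`) z ` {J. J \<subseteq> {1..m} \<and> card J = r} \<subseteq> \<S>"
        using zJ(2,3) unfolding \<S>_def by blast
    qed
    ultimately show ?thesis by auto
  qed
  moreover have "finite (pt ` \<S>)" "card (pt ` \<S>) = m choose r"
    using R n_subsets[OF R(1), of r] card_image[OF inj_pt] by (simp_all add: \<S>_def)
  ultimately show ?thesis
    unfolding star_configuration_def M X by blast
qed

end
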